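(* Let $T$ be a tree on $n\ge 2$ vertices with maximum vertex degree $d_{\max}$. (1) If $n$ is even, then $$b(T)\ge \begin{cases}\frac 2n, & d_{\max}\le \frac n2,\\ \frac{n}{2d_{\max}(n-d_{\max})}, & d_{\max}>\frac n2.\end{cases}$$ (2) If $n$ is odd, then $$b(T)\ge \begin{cases}\frac{2n}{n^2-1}, & d_{\max}\le \lfloor\frac n2\rfloor+1,\\ \frac{n}{2d_{\max}(n-d_{\max})}, & d_{\max}>\lfloor\frac n2\rfloor+1.\end{cases}$$ (3) If $d_{\max}$ divides $n-1$, then $b(T)\le \frac{n}{2k(n-k)}$, where $n-1=kd_{\max}$, $k\in\mathbb{N}$. (4) If $n-1=kd_{\max}+r$ for some $k,r\in\mathbb{N}$ with $1\le r<d_{\max}$, then $b(T)\le \frac{n}{2(k+1)(n-k-1)}$. Moreover, all these bounds are sharp: for all $n\ge 2$ and $d$ for which a tree on $n$ vertices with maximum degree $d$ exists, the lower bound in (1) or (2) and the upper bound in (3) or (4) applicable to $(n,d_{\max}=d)$ are each attained by some tree on $n$ vertices with maximum degree $d$.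
   Context: Graphs are finite, simple, undirected and unweighted. For a graph $G$ with vertex set $V(G)$, $|V(G)|\ge 2$, and edge set $E(G)$, the $\ell_1$-Fiedler value is $$b(G)=\min\Big\{\sum_{uv\in E(G)}|x_u-x_v| : x\in\mathbb{R}^{V(G)},\ \sum_{v\in V(G)}x_v=0,\ \sum_{v\in V(G)}|x_v|=1\Big\}.$$ Here $\mathbb{N}$ denotes the positive integers. *)

theory Defs
  imports Complex_Main "Graph_Theory.Graph_Theory"
begin

text \<open>
  Finite simple undirected graphs are the library's \<open>pair_graph\<close>s: finite loop-free symmetric
  digraphs without parallel arcs, so that an undirected edge \<open>uv\<close> is the pair of opposite arcs
  \<open>(u,v)\<close> and \<open>(v,u)\<close>. Consequently the degree of a vertex is its out-degree.
\<close>

definition max_degree :: "'a pair_pre_digraph \<Rightarrow> nat" where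
  "max_degree G = Max (out_degree (with_proj G) ` pverts G)"

text \<open>
  The library's \<open>tree\<close> cannot be used here: it regards the closed walk \<open>u, v, u\<close> along the two
  opposite arcs of one edge as a cycle, which would exclude every symmetric digraph with an edge.
  The cycles of the undirected graph are the directed cycles with at least three arcs.
\<close>

definition undirected_tree :: "'a pair_pre_digraph \<Rightarrow> bool" where
  "undirected_tree G \<longleftrightarrow>
     pair_graph G \<and>
     Digraph_Component.connected (with_proj G) \<and>
     \<not> (\<exists>p. pre_digraph.cycle (with_proj G) p \<and> 3 \<le> length p)"

text \<open>The factor 1/2 is there because every undirected edge contributes two arcs.\<close>

definition total_variation :: "'a pair_pre_digraph \<Rightarrow> ('a \<Rightarrow> real) \<Rightarrow> real" where
  "total_variation G x = (\<Sum>(u, v)\<in>parcs G. \<bar>x u - x v\<bar>) / 2"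

text \<open>
  The values of \<open>x\<close> outside the vertex set are irrelevant. \<open>LEAST\<close> on the reals denotes an
  attained minimum (it is not an infimum).
\<close>

definition l1_fiedler :: "'a pair_pre_digraph \<Rightarrow> real" where
  "l1_fiedler G =
     (LEAST t. \<exists>x :: 'a \<Rightarrow> real.
        (\<Sum>v\<in>pverts G. x v) = 0 \<and> (\<Sum>v\<in>pverts G. \<bar>x v\<bar>) = 1 \<and> t = total_variation G x)"

definition tree_with :: "nat \<Rightarrow> nat \<Rightarrow> 'a pair_pre_digraph \<Rightarrow> bool" where
  "tree_with n d T \<longleftrightarrow> undirected_tree T \<and> card (pverts T) = n \<and> max_degree T = d"

definition lower_bound_even :: "nat \<Rightarrow> nat \<Rightarrow> real" where
  "lower_bound_even n d =
     (if real d \<le> real n / 2 then 2 / real n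
      else real n / (2 * real d * (real n - real d)))"

definition lower_bound_odd :: "nat \<Rightarrow> nat \<Rightarrow> real" where
  "lower_bound_odd n d =
     (if int d \<le> \<lfloor>real n / 2\<rfloor> + 1 then 2 * real n / ((real n)\<^sup>2 - 1)
      else real n / (2 * real d * (real n - real d)))"

definition upper_bound_dvd :: "nat \<Rightarrow> nat \<Rightarrow> real" where
  "upper_bound_dvd n k = real n / (2 * real k * (real n - real k))"

definition upper_bound_not_dvd :: "nat \<Rightarrow> nat \<Rightarrow> real" where
  "upper_bound_not_dvd n k = real n / (2 * (real k + 1) * (real n - real k - 1))"

end

theory Submission
  imports Defs "HOL-Library.Indicator_Function"
begin

text \<open>
  Number the vertices of a tree so that every vertex other than \<open>0\<close> has exactly one neighbour of
  smaller index, its parent. Expanding a mean-zero vector along the edges shows that \<open>b(T)\<close> is the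
  minimum over all edges of \<open>n / (2 s (n - s))\<close>, where \<open>s\<close> and \<open>n - s\<close> are the numbers of vertices
  on the two sides of the edge, so everything depends on how balanced an edge can be. A vertex of
  degree \<open>d\<close> leaves at least \<open>d\<close> vertices on one side of every edge, which gives the lower bounds. At a
  centroid all branches have at most \<open>n / 2\<close> vertices and one has at least \<open>(n - 1) / d\<close>, which
  gives the upper bounds. Brooms attain the former, spiders with legs of almost equal lengths
  the latter.
\<close>

section \<open>The edge formula for rooted trees\<close>

text \<open>The guard \<open>p j < j\<close> makes the recursion terminate for every function
  \<open>p\<close>. For a parent function it fails only at the root \<open>0\<close>.\<close>

fun ancestors :: "(nat \<Rightarrow> nat) \<Rightarrow> nat \<Rightarrow> nat set" where
  "ancestors p j = insert j (if p j < j then ancestors p (p j) else {})"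

declare ancestors.simps [simp del]

lemma ancestors_subset: "ancestors p j \<subseteq> {..j}"
proof (induction j rule: less_induct)
  case (less j)
  show ?case
    using less[of "p j"] by (subst ancestors.simps) (force split: if_splits)
qed

lemma self_in_ancestors [simp]: "j \<in> ancestors p j"
  by (subst ancestors.simps) simp

lemma finite_ancestors [simp]: "finite (ancestors p j)"
  by (rule finite_subset[OF ancestors_subset]) simp

text \<open>The numbering indexes the edges as well: edge \<open>i\<close> in \<open>{1..<n}\<close>
  joins vertex \<open>i\<close> to its parent. Requiring \<open>p i < i\<close> for all positive
  \<open>i\<close> keeps statements about ancestors free of the bound \<open>n\<close>.\<close>

locale rooted_tree =
  fixes T :: "'a pair_pre_digraph" and n :: nat and f :: "nat \<Rightarrow> 'a" and p :: "nat \<Rightarrow> nat"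
  assumes two_le: "2 \<le> n"
    and parent_less: "\<And>i. 0 < i \<Longrightarrow> p i < i"
    and inj: "inj_on f {..<n}"
    and pverts_eq: "pverts T = f ` {..<n}"
    and parcs_eq: "parcs T =
      (\<lambda>i. (f i, f (p i))) ` {1..<n} \<union> (\<lambda>i. (f (p i), f i)) ` {1..<n}"
begin

abbreviation anc :: "nat \<Rightarrow> nat set" where "anc \<equiv> ancestors p"

text \<open>For \<open>0 < i < n\<close> this is the side of edge \<open>i\<close> away from the
  root.\<close>

definition descendants :: "nat \<Rightarrow> nat set" where
  "descendants i = {j. j < n \<and> i \<in> anc j}"

abbreviation size :: "nat \<Rightarrow> nat" where "size i \<equiv> card (descendants i)"

definition nbrs :: "nat \<Rightarrow> nat set" where
  "nbrs j = {i. i < n \<and> (0 < i \<and> p i = j \<or> 0 < j \<and> i = p j)}"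

lemma anc_Suc: "0 < j \<Longrightarrow> anc j = insert j (anc (p j))"
  using parent_less[of j] by (subst ancestors.simps) simp

lemma anc_0: "anc 0 = {0}"
  by (subst ancestors.simps) simp

lemma parent_notin: "0 < j \<Longrightarrow> j \<notin> anc (p j)"
  using ancestors_subset[of p "p j"] parent_less[of j] by force

lemma zero_in_anc: "0 \<in> anc j"
proof (induction j rule: less_induct)
  case (less j)
  then show ?case using parent_less[of j] by (cases "j = 0") (auto simp: anc_0 anc_Suc)
qed

lemma finite_descendants [simp]: "finite (descendants i)"
  unfolding descendants_def by simp

lemma descendants_subset: "descendants i \<subseteq> {..<n}"
  unfolding descendants_def by auto

lemma self_in_descendants: "i < n \<Longrightarrow> i \<in> descendants i"
  unfolding descendants_def by simp

lemma size_pos: "i < n \<Longrightarrow> 0 < size i"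
  using self_in_descendants card_gt_0_iff by fastforce

lemma size_less: "0 < i \<Longrightarrow> size i < n"
proof -
  assume "0 < i"
  then have "descendants i \<subseteq> {..<n} - {0}"
    by (auto simp: descendants_def anc_0 intro: gr0I)
  then have "size i \<le> card ({..<n} - {0})" by (intro card_mono) auto
  also have "\<dots> < n" using two_le by simp
  finally show ?thesis .
qed

lemma size_0: "size 0 = n"
  by (simp add: descendants_def zero_in_anc)

lemma finite_nbrs [simp]: "finite (nbrs j)"
  unfolding nbrs_def by simp

lemma nbrs_subset: "nbrs j \<subseteq> {..<n} - {j}"
  using parent_less[of j] by (auto simp: nbrs_def)

section \<open>Degrees and total variation in terms of the numbering\<close>

lemma parc_iff:
  assumes "i < n" "j < n"
  shows "(f j, f i) \<in> parcs T \<longleftrightarrow> i \<in> nbrs j"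
proof -
  have P: "p k < n" if "0 < k" "k < n" for k using parent_less[of k] that by simp
  have E: "f a = f b \<longleftrightarrow> a = b" if "a < n" "b < n" for a b
    using inj that by (auto simp: inj_on_def)
  have "(f j, f i) \<in> parcs T \<longleftrightarrow>
      (\<exists>k. 0 < k \<and> k < n \<and> f j = f k \<and> f i = f (p k)) \<or>
      (\<exists>k. 0 < k \<and> k < n \<and> f j = f (p k) \<and> f i = f k)"
    unfolding parcs_eq by (auto simp: Suc_le_eq)
  also have "\<dots> \<longleftrightarrow>
      (\<exists>k. 0 < k \<and> k < n \<and> j = k \<and> i = p k) \<or> (\<exists>k. 0 < k \<and> k < n \<and> j = p k \<and> i = k)"
    using E P assms by (intro arg_cong2[where f = "(\<or>)"] ex_cong1) blast+
  also have "\<dots> \<longleftrightarrow> i \<in> nbrs j"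
    using assms unfolding nbrs_def by blast
  finally show ?thesis .
qed

lemma out_degree_eq:
  assumes "j < n"
  shows "out_degree (with_proj T) (f j) = card (nbrs j)"
proof -
  have P: "p k < n" if "0 < k" "k < n" for k using parent_less[of k] that by simp
  have in_verts: "\<exists>i<n. v = f i" if "(u, v) \<in> parcs T" for u v
  proof -
    have "v \<in> f ` {..<n}"
      using that P unfolding parcs_eq by (auto simp: Suc_le_eq intro!: imageI)
    then show ?thesis by blast
  qed
  have "out_arcs (with_proj T) (f j) = (\<lambda>i. (f j, f i)) ` nbrs j"
  proof (rule set_eqI)
    fix e :: "'a \<times> 'a"
    obtain u v where e: "e = (u, v)" by (cases e)
    have "e \<in> out_arcs (with_proj T) (f j) \<longleftrightarrow> u = f j \<and> (u, v) \<in> parcs T"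
      by (auto simp: e)
    also have "\<dots> \<longleftrightarrow> (\<exists>i<n. u = f j \<and> v = f i \<and> (f j, f i) \<in> parcs T)"
      using in_verts by blast
    also have "\<dots> \<longleftrightarrow> e \<in> (\<lambda>i. (f j, f i)) ` nbrs j"
      using parc_iff[OF _ assms] by (auto simp: e nbrs_def)
    finally show "e \<in> out_arcs (with_proj T) (f j) \<longleftrightarrow> e \<in> (\<lambda>i. (f j, f i)) ` nbrs j" .
  qed
  moreover have "inj_on (\<lambda>i. (f j, f i)) (nbrs j)"
    using inj by (auto simp: inj_on_def nbrs_def)
  ultimately show ?thesis
    by (simp add: out_degree_def card_image)
qed

lemma max_degree_eq: "max_degree T = Max ((\<lambda>j. card (nbrs j)) ` {..<n})"
proof -
  have "out_degree (with_proj T) ` pverts T = (\<lambda>j. card (nbrs j)) ` {..<n}"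
    unfolding pverts_eq image_image by (intro image_cong) (auto simp: out_degree_eq)
  then show ?thesis by (simp add: max_degree_def)
qed

lemma card_nbrs_le: "j < n \<Longrightarrow> card (nbrs j) \<le> max_degree T"
  unfolding max_degree_eq by (intro Max_ge) auto

lemma max_degree_attained: "\<exists>j<n. card (nbrs j) = max_degree T"
proof -
  have "max_degree T \<in> (\<lambda>j. card (nbrs j)) ` {..<n}"
    unfolding max_degree_eq using two_le by (intro Max_in) (auto simp: lessThan_empty_iff)
  then show ?thesis by auto
qed

lemma max_degree_eqI:
  assumes "j < n" "card (nbrs j) = d" "\<And>i. i < n \<Longrightarrow> card (nbrs i) \<le> d"
  shows "max_degree T = d"
  unfolding max_degree_eq using assms by (intro Max_eqI) auto

text \<open>The two orientations of each edge cancel the factor 1/2.\<close>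

lemma total_variation_eq:
  "total_variation T x = (\<Sum>i = 1..<n. \<bar>x (f i) - x (f (p i))\<bar>)"
proof -
  have P: "p k < n" if "1 \<le> k" "k < n" for k using parent_less[of k] that by simp
  have E: "f a = f b \<longleftrightarrow> a = b" if "a < n" "b < n" for a b
    using inj that by (auto simp: inj_on_def)
  have i1: "inj_on (\<lambda>i. (f i, f (p i))) {1..<n}" "inj_on (\<lambda>i. (f (p i), f i)) {1..<n}"
    using inj by (auto simp: inj_on_def)
  \<comment> \<open>A common arc would give \<open>i = p k < k = p i < i\<close>.\<close>
  have dis: "(\<lambda>i. (f i, f (p i))) ` {1..<n} \<inter> (\<lambda>i. (f (p i), f i)) ` {1..<n} = {}"
  proof -
    have False if "i \<in> {1..<n}" "k \<in> {1..<n}" "f i = f (p k)" "f (p i) = f k" for i k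
      using that E P parent_less[of i] parent_less[of k] by (auto simp: Suc_le_eq)
    then show ?thesis by blast
  qed
  have "(\<Sum>(u, v)\<in>parcs T. \<bar>x u - x v\<bar>) =
      (\<Sum>i = 1..<n. \<bar>x (f i) - x (f (p i))\<bar>) + (\<Sum>i = 1..<n. \<bar>x (f (p i)) - x (f i)\<bar>)"
    unfolding parcs_eq
    by (subst sum.union_disjoint[OF _ _ dis])
      (simp_all add: sum.reindex[OF i1(1)] sum.reindex[OF i1(2)] o_def del: One_nat_def)
  then show ?thesis
    unfolding total_variation_def by (simp add: abs_minus_commute)
qed

lemma sum_pverts: "(\<Sum>v\<in>pverts T. g v) = (\<Sum>j<n. g (f j))"
  unfolding pverts_eq by (simp add: sum.reindex[OF inj])

section \<open>Expansion along the edges and the extremal vectors\<close>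

text \<open>The positive ancestors of \<open>j\<close> are the edges on the path from the root to
  \<open>j\<close>, and increments along a path telescope. Indicators let the sum range over all
  edges, so that it can later be swapped with a sum over \<open>j\<close>.\<close>

lemma telescope:
  fixes y :: "nat \<Rightarrow> real"
  assumes "j < n"
  shows "y j = y 0 + (\<Sum>i = 1..<n. (y i - y (p i)) * indicator (anc j) i)"
  using assms
proof (induction j rule: less_induct)
  case (less j)
  show ?case
  proof (cases "j = 0")
    case True
    then show ?thesis by (auto simp: anc_0 indicator_def intro!: sum.neutral)
  next
    case False
    then have j: "0 < j" by simp
    have "(\<Sum>i = 1..<n. (y i - y (p i)) * indicator (anc j) i) =
       (\<Sum>i = 1..<n. (y i - y (p i)) * indicator (anc (p j)) i + (if i = j then y j - y (p j) else 0))"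
      using parent_notin[OF j] by (intro sum.cong) (auto simp: anc_Suc[OF j] indicator_def)
    also have "\<dots> = (\<Sum>i = 1..<n. (y i - y (p i)) * indicator (anc (p j)) i) + (y j - y (p j))"
      using j less.prems by (simp add: sum.distrib)
    finally show ?thesis
      using less.IH[of "p j"] parent_less[OF j] less.prems by simp
  qed
qed

lemma sum_indicator_anc: "(\<Sum>j<n. indicator (anc j) i) = real (size i)"
proof -
  have "(\<Sum>j<n. indicator (anc j) i :: real) = (\<Sum>j<n. if i \<in> anc j then 1 else 0)"
    by (intro sum.cong) (auto simp: indicator_def)
  also have "\<dots> = real (card ({..<n} \<inter> {j. i \<in> anc j}))"
    by (simp add: sum.If_cases)
  also have "{..<n} \<inter> {j. i \<in> anc j} = descendants i"
    by (auto simp: descendants_def)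
  finally show ?thesis .
qed

text \<open>With \<open>s = size i\<close>, there are \<open>s\<close> summands equal to
  \<open>1 - s / n\<close> and \<open>n - s\<close> equal to \<open>s / n\<close>.\<close>

lemma sum_abs_centred_indicator:
  assumes "0 < i" "i < n"
  shows "(\<Sum>j<n. \<bar>indicator (anc j) i - real (size i) / n\<bar>) = 2 * real (size i) * (real n - size i) / n"
proof -
  let ?s = "real (size i)"
  have s: "0 \<le> ?s / n" "?s / n \<le> 1" using size_less[OF assms(1)] two_le by auto
  \<comment> \<open>For \<open>0 \<le> a \<le> 1\<close> the function
    \<open>\<bar>t - a\<bar>\<close> agrees on \<open>t = 0\<close> and \<open>t = 1\<close> with
    the affine function \<open>(1 - 2 * a) * t + a\<close>.\<close>
  have "(\<Sum>j<n. \<bar>indicator (anc j) i - ?s / n\<bar>) =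
      (\<Sum>j<n. (1 - 2 * ?s / n) * indicator (anc j) i + ?s / n)"
    using s by (intro sum.cong) (auto simp: indicator_def)
  also have "\<dots> = (1 - 2 * ?s / n) * ?s + ?s"
    using two_le by (simp add: sum.distrib sum_distrib_left[symmetric] sum_indicator_anc)
  also have "\<dots> = 2 * ?s * (real n - ?s) / n"
    using two_le by (simp add: field_simps)
  finally show ?thesis .
qed

text \<open>
  A mean-zero \<open>y\<close> is the combination of the centred indicators of the descendant sets
  with the edge increments of \<open>y\<close> as coefficients.
\<close>
lemma sum_abs_le:
  fixes y :: "nat \<Rightarrow> real"
  assumes "(\<Sum>j<n. y j) = 0"
  shows "(\<Sum>j<n. \<bar>y j\<bar>) \<le>
    (\<Sum>i = 1..<n. \<bar>y i - y (p i)\<bar> * (2 * real (size i) * (real n - size i) / n))"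
proof -
  let ?d = "\<lambda>i. y i - y (p i)"
  \<comment> \<open>Summing the telescoped formula over all vertices determines the value at the
    root, because \<open>y\<close> has mean zero.\<close>
  have "0 = (\<Sum>j<n. y 0 + (\<Sum>i = 1..<n. ?d i * indicator (anc j) i))"
    unfolding assms[symmetric] by (intro sum.cong refl telescope) simp
  also have "\<dots> = n * y 0 + (\<Sum>i = 1..<n. \<Sum>j<n. ?d i * indicator (anc j) i)"
    by (simp add: sum.distrib sum.swap[of _ "{..<n}"])
  also have "\<dots> = n * y 0 + (\<Sum>i = 1..<n. ?d i * size i)"
    by (simp add: sum_distrib_left[symmetric] sum_indicator_anc)
  finally have y0: "y 0 = - (\<Sum>i = 1..<n. ?d i * size i) / n"
    using two_le by (simp add: field_simps)
  have y: "y j = (\<Sum>i = 1..<n. ?d i * (indicator (anc j) i - size i / n))" if "j < n" for j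
    by (subst telescope[OF that], subst y0)
      (simp add: right_diff_distrib sum_subtractf sum_divide_distrib)
  have "(\<Sum>j<n. \<bar>y j\<bar>) \<le> (\<Sum>j<n. \<Sum>i = 1..<n. \<bar>?d i * (indicator (anc j) i - size i / n)\<bar>)"
    by (rule sum_mono, subst y) (auto intro: sum_abs)
  also have "\<dots> = (\<Sum>i = 1..<n. \<bar>?d i\<bar> * (\<Sum>j<n. \<bar>indicator (anc j) i - size i / n\<bar>))"
    by (subst sum.swap) (simp add: abs_mult sum_distrib_left)
  also have "\<dots> = (\<Sum>i = 1..<n. \<bar>?d i\<bar> * (2 * real (size i) * (real n - size i) / n))"
    by (intro sum.cong) (auto simp: sum_abs_centred_indicator Suc_le_eq)
  finally show ?thesis .
qed

abbreviation admissible :: "('a \<Rightarrow> real) \<Rightarrow> bool" where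
  "admissible x \<equiv> (\<Sum>v\<in>pverts T. x v) = 0 \<and> (\<Sum>v\<in>pverts T. \<bar>x v\<bar>) = 1"

text \<open>In \<open>sum_abs_le\<close> the left side is 1, and each edge weight on the right is at
  most \<open>2 * M / n\<close>.\<close>

lemma total_variation_ge:
  assumes M: "\<And>i. 0 < i \<Longrightarrow> i < n \<Longrightarrow> real (size i) * (real n - size i) \<le> M"
    and M0: "0 < M" and x: "admissible x"
  shows "n / (2 * M) \<le> total_variation T x"
proof -
  let ?y = "\<lambda>j. x (f j)"
  have "1 = (\<Sum>j<n. \<bar>?y j\<bar>)" using x by (simp add: sum_pverts)
  also have "\<dots> \<le> (\<Sum>i = 1..<n. \<bar>?y i - ?y (p i)\<bar> * (2 * real (size i) * (real n - size i) / n))"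
    by (rule sum_abs_le) (use x in \<open>simp add: sum_pverts\<close>)
  also have "\<dots> \<le> (\<Sum>i = 1..<n. \<bar>?y i - ?y (p i)\<bar> * (2 * M / n))"
    using M by (intro sum_mono mult_left_mono divide_right_mono) (auto simp: Suc_le_eq mult.assoc)
  also have "\<dots> = total_variation T x * (2 * M / n)"
    unfolding total_variation_eq sum_distrib_right ..
  finally show ?thesis using M0 two_le by (simp add: field_simps)
qed

text \<open>The centred indicator of \<open>descendants i\<close>, scaled to norm 1, jumps only
  across edge \<open>i\<close>, so its total variation is the scaling factor.\<close>

lemma total_variation_attained:
  assumes i: "0 < i" "i < n"
  shows "\<exists>x. admissible x \<and> total_variation T x = n / (2 * (size i * (real n - size i)))"
proof -
  let ?s = "real (size i)"
  \<comment> \<open>The reciprocal of the norm found in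
    \<open>sum_abs_centred_indicator\<close>.\<close>
  define c where "c = n / (2 * (?s * (real n - ?s)))"
  define x where "x v = c * (indicator (anc (the_inv_into {..<n} f v)) i - ?s / n)" for v
  have s: "0 < ?s" "?s < n" using size_pos[OF i(2)] size_less[OF i(1)] by auto
  have c: "0 < c" using s by (simp add: c_def)
  have xf: "x (f j) = c * (indicator (anc j) i - ?s / n)" if "j < n" for j
    using that by (simp add: x_def the_inv_into_f_f[OF inj])
  have "(\<Sum>v\<in>pverts T. x v) = c * ((\<Sum>j<n. indicator (anc j) i) - n * (?s / n))"
    by (simp add: sum_pverts xf sum_distrib_left[symmetric] sum_subtractf)
  then have 1: "(\<Sum>v\<in>pverts T. x v) = 0"
    using two_le by (simp add: sum_indicator_anc)
  have "(\<Sum>v\<in>pverts T. \<bar>x v\<bar>) = c * (\<Sum>j<n. \<bar>indicator (anc j) i - ?s / n\<bar>)"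
    using c by (simp add: sum_pverts xf sum_distrib_left abs_mult)
  also have "\<dots> = 1"
    unfolding sum_abs_centred_indicator[OF i] c_def using s two_le
      self_in_descendants[OF i(2)]
    by (simp only: mult.assoc) (auto simp: divide_simps)
  finally have 2: "(\<Sum>v\<in>pverts T. \<bar>x v\<bar>) = 1" .
  have "\<bar>x (f k) - x (f (p k))\<bar> = (if k = i then c else 0)" if "k \<in> {1..<n}" for k
  proof -
    have k: "0 < k" "k < n" "p k < n" using that parent_less[of k] by auto
    have "x (f k) - x (f (p k)) = c * (indicator (anc k) i - indicator (anc (p k)) i)"
      using k by (simp add: xf algebra_simps)
    also have "\<dots> = (if k = i then c else 0)"
      using parent_notin[OF k(1)] by (auto simp: anc_Suc[OF k(1)] indicator_def)
    finally show ?thesis using c by simp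
  qed
  then have "total_variation T x = c"
    using i by (simp add: total_variation_eq)
  with 1 2 show ?thesis unfolding c_def by blast
qed

text \<open>The optimum is attained on an edge, which makes the \<open>LEAST\<close> in \<open>l1_fiedler\<close> meaningful.\<close>
lemma l1_fiedler_is_least:
  shows "\<exists>x. admissible x \<and> total_variation T x = l1_fiedler T"
    and "admissible x \<Longrightarrow> l1_fiedler T \<le> total_variation T x"
proof -
  let ?w = "\<lambda>i. real (size i) * (real n - size i)"
  have ne: "{1..<n} \<noteq> {}" using two_le by auto
  \<comment> \<open>A most balanced edge: it serves both as the bound \<open>M\<close> and as the
    source of the optimal vector.\<close>
  obtain i where i: "i \<in> {1..<n}" and mx: "\<And>k. k \<in> {1..<n} \<Longrightarrow> ?w k \<le> ?w i"
    using Max_in[of "?w ` {1..<n}"] Max_ge[of "?w ` {1..<n}"] ne by fastforce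
  have w: "0 < ?w i" using i size_pos[of i] size_less[of i] by simp
  obtain x0 where x0: "admissible x0" "total_variation T x0 = n / (2 * ?w i)"
    using total_variation_attained[of i] i by auto
  have least: "n / (2 * ?w i) \<le> total_variation T x" if "admissible x" for x
    by (rule total_variation_ge) (use mx w that in auto)
  have "l1_fiedler T = n / (2 * ?w i)"
    unfolding l1_fiedler_def using x0 least by (intro Least_equality) auto
  then show "\<exists>x. admissible x \<and> total_variation T x = l1_fiedler T"
    and "admissible x \<Longrightarrow> l1_fiedler T \<le> total_variation T x"
    using x0 least by auto
qed

lemma l1_fiedler_ge:
  assumes "\<And>i. 0 < i \<Longrightarrow> i < n \<Longrightarrow> real (size i) * (real n - size i) \<le> M" "0 < M"
  shows "n / (2 * M) \<le> l1_fiedler T"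
  using l1_fiedler_is_least(1) total_variation_ge[OF assms] by metis

lemma l1_fiedler_le:
  assumes "0 < i" "i < n"
  shows "l1_fiedler T \<le> n / (2 * (size i * (real n - size i)))"
  using total_variation_attained[OF assms] l1_fiedler_is_least(2) by metis

end

section \<open>Balanced edges and the maximum degree\<close>

text \<open>The right side minus the left side factors as
  \<open>(s - K) * (n - s - K)\<close>.\<close>

lemma mult_diff_mono:
  fixes K s n :: nat
  assumes "K \<le> s" "s + K \<le> n"
  shows "real K * (real n - K) \<le> real s * (real n - s)"
proof -
  have "0 \<le> (real s - K) * (real n - s - K)"
    using assms by (intro mult_nonneg_nonneg) (simp_all add: algebra_simps flip: of_nat_add)
  then show ?thesis by (simp add: algebra_simps)
qed

lemma four_mult_diff_le: "4 * (s * (n - s)) \<le> (n::real)\<^sup>2"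
  using zero_le_power2[of "n - 2 * s"] by (simp add: power2_eq_square algebra_simps)

text \<open>For odd \<open>n\<close> the integer \<open>n - 2 * s\<close> is nonzero, so its square,
  which is \<open>n * n - 4 * s * (n - s)\<close>, is at least 1.\<close>

lemma four_mult_diff_le_odd:
  fixes s n :: nat
  assumes "odd n"
  shows "4 * (real s * (real n - s)) \<le> (real n)\<^sup>2 - 1"
proof -
  have "int n - 2 * int s \<noteq> 0" using assms by presburger
  then have "1 \<le> (int n - 2 * int s)\<^sup>2"
    by (smt (verit) zero_le_power2 zero_eq_power2)
  then have "1 \<le> (real n - 2 * real s)\<^sup>2"
    by (metis (mono_tags) of_int_1_le_iff of_int_diff of_int_mult of_int_numeral of_int_of_nat_eq
        of_int_power)
  then show ?thesis by (simp add: power2_eq_square algebra_simps)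
qed

section \<open>Lower bounds from a vertex of maximum degree\<close>

context rooted_tree
begin

lemma parent_lt_n: "0 < k \<Longrightarrow> k < n \<Longrightarrow> p k < n"
  using parent_less[of k] by simp

text \<open>Edge \<open>i\<close> is the only one between \<open>descendants i\<close> and its
  complement: a vertex \<open>k\<close> and its parent differ in their ancestors by \<open>k\<close>
  alone, hence they lie on the same side unless \<open>k = i\<close>.\<close>

lemma nbrs_across:
  assumes "m \<in> nbrs j" "j < n" "0 < i" "(m \<in> descendants i) \<noteq> (j \<in> descendants i)"
  shows "m = (if j = i then p i else i)"
proof -
  have *: "k = i" if "0 < k" "k < n" "(k \<in> descendants i) \<noteq> (p k \<in> descendants i)" for k
    using that parent_lt_n[of k] by (auto simp: descendants_def anc_Suc)
  from assms(1,2) consider "0 < m" "m < n" "p m = j" | "0 < j" "j < n" "m = p j"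
    by (auto simp: nbrs_def)
  then show ?thesis
  proof cases
    case 1
    then show ?thesis using *[of m] assms parent_less[of i] by auto
  next
    case 2
    then show ?thesis using *[of j] assms by auto
  qed
qed

text \<open>The at most one neighbour outside \<open>B\<close> is made up for by \<open>j\<close>,
  which lies in \<open>B\<close> but is not its own neighbour.\<close>

lemma card_nbrs_le_card:
  assumes "finite B" "j \<in> B" "nbrs j - B \<subseteq> {m}"
  shows "card (nbrs j) \<le> card B"
proof -
  have j: "j \<notin> nbrs j" using nbrs_subset by blast
  have "card (nbrs j) = card (nbrs j \<inter> B) + card (nbrs j - B)"
    by (subst card_Un_disjoint[symmetric]) (auto intro: arg_cong[where f = card])
  also have "card (nbrs j - B) \<le> 1"
    using card_mono[OF _ assms(3)] by simp
  also have "card (nbrs j \<inter> B) + 1 = card (insert j (nbrs j \<inter> B))"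
    using j by simp
  also have "\<dots> \<le> card B" using assms by (intro card_mono) auto
  finally show ?thesis by simp
qed

text \<open>The side containing a vertex of maximum degree contains all but at most one of its
  neighbours, by \<open>nbrs_across\<close>.\<close>

lemma max_degree_le_side:
  assumes "0 < i" "i < n"
  shows "max_degree T \<le> size i \<or> max_degree T \<le> n - size i"
proof -
  obtain j where j: "j < n" "card (nbrs j) = max_degree T"
    using max_degree_attained by blast
  show ?thesis
  proof (cases "j \<in> descendants i")
    case True
    then have "nbrs j - descendants i \<subseteq> {if j = i then p i else i}"
      using nbrs_across[OF _ j(1) assms(1)] by blast
    with True show ?thesis using card_nbrs_le_card[of "descendants i" j] j by simp
  next
    case False
    then have "nbrs j - ({..<n} - descendants i) \<subseteq> {if j = i then p i else i}"
      using nbrs_across[OF _ j(1) assms(1)] by (auto simp: nbrs_def)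
    with False have "card (nbrs j) \<le> card ({..<n} - descendants i)"
      using card_nbrs_le_card[of "{..<n} - descendants i" j] j by simp
    then show ?thesis using j descendants_subset by (simp add: card_Diff_subset)
  qed
qed

text \<open>One side of every edge has at least \<open>max_degree T\<close> vertices, which is at
  least half of them, so no split is more balanced than \<open>max_degree T\<close> against the
  rest.\<close>

lemma l1_fiedler_ge_max_degree:
  assumes "n \<le> 2 * max_degree T" "max_degree T < n"
  shows "n / (2 * (real (max_degree T) * (real n - max_degree T))) \<le> l1_fiedler T"
proof (rule l1_fiedler_ge)
  let ?d = "max_degree T"
  fix i assume i: "0 < i" "i < n"
  have s: "size i < n" by (rule size_less) fact
  from max_degree_le_side[OF i]
  show "real (size i) * (real n - size i) \<le> real ?d * (real n - ?d)"
  proof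
    assume "?d \<le> size i"
    \<comment> \<open>Monotonicity is applied to the smaller parts \<open>n - size i\<close> and
      \<open>n - ?d\<close>.\<close>
    then have "real (n - size i) * (real n - real (n - size i)) \<le> real (n - ?d) * (real n - real (n - ?d))"
      using assms s by (intro mult_diff_mono) auto
    then show ?thesis using assms s by (simp add: of_nat_diff mult.commute)
  next
    assume "?d \<le> n - size i"
    then have "real (size i) * (real n - size i) \<le> real (n - ?d) * (real n - real (n - ?d))"
      using assms s by (intro mult_diff_mono) auto
    then show ?thesis using assms s by (simp add: of_nat_diff mult.commute)
  qed
next
  show "0 < real (max_degree T) * (real n - real (max_degree T))"
    using assms two_le by auto
qed

lemma one_in_nbrs_0: "1 \<in> nbrs 0"
  using parent_less[of 1] two_le by (auto simp: nbrs_def)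

lemma max_degree_pos: "0 < max_degree T"
proof -
  have "0 < card (nbrs 0)" using one_in_nbrs_0 by (auto simp: card_gt_0_iff)
  then show ?thesis using card_nbrs_le[of 0] two_le by linarith
qed

lemma max_degree_less: "max_degree T < n"
proof -
  obtain j where j: "j < n" "card (nbrs j) = max_degree T"
    using max_degree_attained by blast
  have "card (nbrs j) \<le> card ({..<n} - {j})" by (intro card_mono nbrs_subset) simp
  then show ?thesis using j by simp
qed

text \<open>The vertices \<open>0\<close>, \<open>1\<close>, \<open>2\<close> form a path with
  middle vertex \<open>p 2\<close>.\<close>

lemma max_degree_ge_2:
  assumes "3 \<le> n"
  shows "2 \<le> max_degree T"
proof -
  have p: "p 1 = 0" "p 2 = 0 \<or> p 2 = 1" using parent_less[of 1] parent_less[of 2] by auto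
  obtain j a b where j: "j < n" "a \<noteq> b" "{a, b} \<subseteq> nbrs j"
  proof (cases "p 2 = 0")
    case True
    then have "1 \<in> nbrs 0" "2 \<in> nbrs 0" using p assms by (auto simp: nbrs_def)
    then show ?thesis using that[of 0 1 2] assms by simp
  next
    case False
    then have "0 \<in> nbrs 1" "2 \<in> nbrs 1" using p assms by (auto simp: nbrs_def)
    then show ?thesis using that[of 1 0 2] assms by simp
  qed
  have "card {a, b} \<le> card (nbrs j)" using j(3) by (intro card_mono) auto
  then show ?thesis using j card_nbrs_le[of j] by simp
qed

text \<open>For small degrees the perfectly balanced split, with \<open>s * (n - s)\<close> equal to
  a quarter of the square of \<open>n\<close>, is the only obstacle; for larger ones the degree
  forces imbalance.\<close>

theorem lower_bound_even_le:
  assumes "even n"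
  shows "lower_bound_even n (max_degree T) \<le> l1_fiedler T"
proof (cases "real (max_degree T) \<le> real n / 2")
  case True
  have "n / (2 * ((real n)\<^sup>2 / 4)) \<le> l1_fiedler T"
    using four_mult_diff_le two_le by (intro l1_fiedler_ge) (auto simp: mult.commute)
  then show ?thesis using True two_le
    by (simp add: lower_bound_even_def power2_eq_square field_simps)
next
  case False
  then show ?thesis
    using l1_fiedler_ge_max_degree max_degree_less by (simp add: lower_bound_even_def mult.assoc)
qed

text \<open>At degree \<open>\<lfloor>n / 2\<rfloor> + 1\<close> the two formulas agree, since this
  degree and its complement in \<open>n\<close> already form the most balanced split.\<close>

theorem lower_bound_odd_le:
  assumes "odd n"
  shows "lower_bound_odd n (max_degree T) \<le> l1_fiedler T"
proof (cases "int (max_degree T) \<le> \<lfloor>real n / 2\<rfloor> + 1")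
  case True
  have "1\<^sup>2 < (real n)\<^sup>2" using two_le by (intro power_strict_mono) auto
  then have n: "1 < (real n)\<^sup>2" by simp
  have "n / (2 * (((real n)\<^sup>2 - 1) / 4)) \<le> l1_fiedler T"
    using four_mult_diff_le_odd[OF assms] n by (intro l1_fiedler_ge) (auto simp: mult.commute)
  then show ?thesis using True n
    by (simp add: lower_bound_odd_def field_simps)
next
  case False
  then have "n \<le> 2 * max_degree T" by linarith
  with False show ?thesis
    using l1_fiedler_ge_max_degree max_degree_less by (simp add: lower_bound_odd_def mult.assoc)
qed

section \<open>Upper bounds from a branch at a centroid\<close>

definition children :: "nat \<Rightarrow> nat set" where
  "children j = {c. 0 < c \<and> c < n \<and> p c = j}"

lemma finite_children [simp]: "finite (children j)"
  by (simp add: children_def)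

lemma nbrs_eq: "j < n \<Longrightarrow> nbrs j = children j \<union> (if 0 < j then {p j} else {})"
  using parent_lt_n[of j] by (auto simp: nbrs_def children_def)

text \<open>On the way up from a proper descendant to \<open>j\<close>, the last vertex before
  \<open>j\<close> is a child of \<open>j\<close>.\<close>

lemma descendants_subset_children:
  "descendants j \<subseteq> insert j (\<Union>c\<in>children j. descendants c)"
proof
  fix k assume "k \<in> descendants j"
  then show "k \<in> insert j (\<Union>c\<in>children j. descendants c)"
  proof (induction k rule: less_induct)
    case (less k)
    show ?case
    proof (cases "k = j")
      case False
      from less.prems have k': "k < n" "j \<in> anc k" by (auto simp: descendants_def)
      then have "0 < k" using False by (auto simp: anc_0 intro!: gr0I)
      with False k' have k: "0 < k" "k < n" "j \<in> anc (p k)" by (auto simp: anc_Suc)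
      then have "p k \<in> descendants j" using parent_lt_n[of k] by (simp add: descendants_def)
      then have "p k = j \<or> (\<exists>c\<in>children j. p k \<in> descendants c)"
        using less.IH[of "p k"] parent_less[of k] k by blast
      then show ?thesis
      proof
        assume "p k = j"
        then have "k \<in> children j" using k by (simp add: children_def)
        then show ?thesis using self_in_descendants[OF k(2)] by blast
      next
        assume "\<exists>c\<in>children j. p k \<in> descendants c"
        then show ?thesis using k by (auto simp: descendants_def anc_Suc)
      qed
    qed simp
  qed
qed

text \<open>The union bound suffices, since the centroid argument wants the branches to be large in
  total.\<close>

lemma size_le_children: "size j \<le> 1 + (\<Sum>c\<in>children j. size c)"
proof -
  have "size j \<le> card (insert j (\<Union>c\<in>children j. descendants c))"
    by (intro card_mono descendants_subset_children) auto
  also have "\<dots> \<le> 1 + card (\<Union>c\<in>children j. descendants c)"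
    by (simp add: card_insert_if)
  also have "\<dots> \<le> 1 + (\<Sum>c\<in>children j. size c)"
    by (simp add: card_UN_le)
  finally show ?thesis .
qed

text \<open>
  The last vertex with at least \<open>n/2\<close> descendants is a centroid: all branches at it
  have at most \<open>n/2\<close> vertices, and one of them has at least the average size.
\<close>
lemma centroid_branch:
  "\<exists>i c. 0 < i \<and> i < n \<and> (c = size i \<or> c = n - size i) \<and> n - 1 \<le> c * max_degree T \<and> 2 * c \<le> n"
proof -
  \<comment> \<open>\<open>J\<close> contains the root. Children have larger indices than their
    parent, so no child of the maximum \<open>j\<close> belongs to \<open>J\<close>.\<close>
  define J where "J = {j. j < n \<and> n \<le> 2 * size j}"
  define j where "j = Max J"
  have J: "finite J" "0 \<in> J" using two_le by (auto simp: J_def size_0)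
  then have "j \<in> J" unfolding j_def by (intro Max_in) auto
  then have j: "j < n" "n \<le> 2 * size j" by (auto simp: J_def)
  have ch: "2 * size c < n" if "c \<in> children j" for c
  proof -
    have "c \<notin> J"
      using that Max_ge[OF J(1), of c] parent_less[of c] by (auto simp: children_def simp flip: j_def)
    then show ?thesis using that by (auto simp: J_def children_def)
  qed
  \<comment> \<open>The size of the branch at \<open>j\<close> through its neighbour
    \<open>m\<close>; the branch through the parent is everything but the descendants of
    \<open>j\<close>.\<close>
  define b where "b m = (if m \<in> children j then size m else n - size j)" for m
  have b_edge: "\<exists>i. 0 < i \<and> i < n \<and> (b m = size i \<or> b m = n - size i) \<and> 2 * b m \<le> n"
    if "m \<in> nbrs j" for m
  proof (cases "m \<in> children j")
    case True
    then show ?thesis using ch[OF True] by (intro exI[of _ m]) (auto simp: b_def children_def)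
  next
    case False
    then have "0 < j" using that nbrs_eq[OF j(1)] by (auto split: if_splits)
    then show ?thesis using False j by (intro exI[of _ j]) (auto simp: b_def)
  qed
  have sj: "size j \<le> n" using card_mono[OF _ descendants_subset] by simp
  have total: "n - 1 \<le> (\<Sum>m\<in>nbrs j. b m)"
  proof (cases "0 < j")
    case True
    have "p j \<notin> children j" using parent_less[of "p j"] parent_less[of j] True
      by (auto simp: children_def)
    then have "(\<Sum>m\<in>nbrs j. b m) = (n - size j) + (\<Sum>c\<in>children j. size c)"
      using True by (simp add: nbrs_eq[OF j(1)] b_def cong: sum.cong)
    then show ?thesis using size_le_children[of j] sj by simp
  next
    case False
    then have "nbrs j = children j" using nbrs_eq[OF j(1)] by simp
    then have "(\<Sum>m\<in>nbrs j. b m) = (\<Sum>c\<in>children j. size c)"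
      by (simp add: b_def)
    then show ?thesis using size_le_children[of j] False size_0 by simp
  qed
  \<comment> \<open>Averaging over at most \<open>max_degree T\<close> branches, in multiplied form
    to stay within the natural numbers.\<close>
  have "\<exists>m\<in>nbrs j. n - 1 \<le> b m * max_degree T"
  proof (rule ccontr)
    assume "\<not> ?thesis"
    then have "b m * max_degree T \<le> n - 2" if "m \<in> nbrs j" for m
      using that by fastforce
    then have "(\<Sum>m\<in>nbrs j. b m * max_degree T) \<le> card (nbrs j) * (n - 2)"
      using sum_bounded_above[of "nbrs j" "\<lambda>m. b m * max_degree T" "n - 2"] by simp
    also have "\<dots> \<le> max_degree T * (n - 2)"
      using card_nbrs_le[OF j(1)] by simp
    finally have "(\<Sum>m\<in>nbrs j. b m) * max_degree T \<le> (n - 2) * max_degree T"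
      by (simp only: sum_distrib_right mult.commute[of "max_degree T"])
    then have "(\<Sum>m\<in>nbrs j. b m) \<le> n - 2" using max_degree_pos by simp
    then show False using total two_le by simp
  qed
  then show ?thesis using b_edge by blast
qed

text \<open>The centroid branch has between \<open>K\<close> and \<open>n / 2\<close> vertices, so
  its edge is at least as balanced as a split into \<open>K\<close> and \<open>n - K\<close>. In the
  applications \<open>K\<close> is \<open>(n - 1) / max_degree T\<close> rounded up.\<close>

lemma l1_fiedler_le_branch:
  assumes "0 < K" "\<And>c. n - 1 \<le> c * max_degree T \<Longrightarrow> K \<le> c"
  shows "l1_fiedler T \<le> n / (2 * (real K * (real n - K)))"
proof -
  obtain i c where i: "0 < i" "i < n" and c: "c = size i \<or> c = n - size i"
    and c2: "n - 1 \<le> c * max_degree T" "2 * c \<le> n"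
    using centroid_branch by blast
  have K: "K \<le> c" using assms(2) c2(1) .
  then have Kn: "K < n" using c2(2) two_le by linarith
  have "real K * (real n - K) \<le> real c * (real n - c)"
    using K c2 by (intro mult_diff_mono) auto
  also have "\<dots> = real (size i) * (real n - size i)"
    using c size_less[OF i(1)] by (auto simp: of_nat_diff mult.commute)
  finally have "n / (2 * (real (size i) * (real n - size i))) \<le> n / (2 * (real K * (real n - K)))"
    using assms(1) Kn by (intro divide_left_mono mult_left_mono) (auto intro!: mult_pos_pos
        simp: size_pos[OF i(2)] size_less[OF i(1)])
  then show ?thesis using l1_fiedler_le[OF i] by linarith
qed

theorem upper_bound_dvd_ge:
  assumes "1 \<le> k" "n - 1 = k * max_degree T"
  shows "l1_fiedler T \<le> upper_bound_dvd n k"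
proof -
  have "l1_fiedler T \<le> n / (2 * (real k * (real n - k)))"
    using assms max_degree_pos by (intro l1_fiedler_le_branch) auto
  then show ?thesis by (simp add: upper_bound_dvd_def mult.assoc)
qed

text \<open>The positive remainder makes the quotient, rounded up, at least
  \<open>k + 1\<close>.\<close>

theorem upper_bound_not_dvd_ge:
  assumes "1 \<le> r" "n - 1 = k * max_degree T + r"
  shows "l1_fiedler T \<le> upper_bound_not_dvd n k"
proof -
  have "k + 1 \<le> c" if "n - 1 \<le> c * max_degree T" for c
  proof -
    have "k * max_degree T < c * max_degree T" using that assms by linarith
    then show ?thesis by simp
  qed
  then have "l1_fiedler T \<le> n / (2 * (real (k + 1) * (real n - real (k + 1))))"
    by (intro l1_fiedler_le_branch) auto
  then show ?thesis by (simp add: upper_bound_not_dvd_def algebra_simps)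
qed

end

section \<open>Undirected trees are rooted trees\<close>

context rooted_tree
begin

lemma nbrs_sym: "i \<in> nbrs j \<Longrightarrow> j < n \<Longrightarrow> j \<in> nbrs i"
  by (auto simp: nbrs_def)

lemma pair_graph: "pair_graph T"
proof
  have sub: "parcs T \<subseteq> pverts T \<times> pverts T"
    using parent_lt_n unfolding parcs_eq pverts_eq by (auto simp: Suc_le_eq intro!: imageI)
  show "e \<in> parcs T \<Longrightarrow> fst e \<in> pverts T" "e \<in> parcs T \<Longrightarrow> snd e \<in> pverts T" for e
    using sub by auto
  show "finite (pverts T)" "finite (parcs T)"
    by (simp_all add: pverts_eq parcs_eq)
  show "symmetric (with_proj T)"
    unfolding symmetric_def sym_def by (auto simp: parcs_eq)
  show "fst e \<noteq> snd e" if e: "e \<in> parcs T" for e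
  proof -
    have "f (p i) \<noteq> f i" if "0 < i" "i < n" for i
      using inj_onD[OF inj, of "p i" i] parent_less[of i] that by auto
    then have *: "f i \<noteq> f (p i)" "f (p i) \<noteq> f i" if "i \<in> {1..<n}" for i
      using that by (metis Suc_le_eq One_nat_def atLeastLessThan_iff)+
    from e show ?thesis
      unfolding parcs_eq by (elim UnE imageE) (simp_all only: fst_conv snd_conv * not_False_eq_True)
  qed
qed

text \<open>Every vertex reaches the root through its ancestors, and symmetry of the arcs reverses
  these walks.\<close>

lemma strongly_connected: "strongly_connected (with_proj T)"
proof -
  interpret pair_graph T by (rule pair_graph)
  have root: "f j \<rightarrow>\<^sup>*\<^bsub>with_proj T\<^esub> f 0" if "j < n" for j
    using that
  proof (induction j rule: less_induct)
    case (less j)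
    show ?case
    proof (cases "j = 0")
      case True
      then show ?thesis using two_le by (simp add: pverts_eq)
    next
      case False
      then have "(f j, f (p j)) \<in> parcs T" using less.prems by (auto simp: parcs_eq Suc_le_eq)
      moreover have "f (p j) \<rightarrow>\<^sup>*\<^bsub>with_proj T\<^esub> f 0"
        using less.IH[of "p j"] False less.prems parent_less[of j] by simp
      ultimately show ?thesis using adj_reachable_trans by blast
    qed
  qed
  show ?thesis
  proof (rule strongly_connectedI)
    show "verts (with_proj T) \<noteq> {}" using two_le by (auto simp: pverts_eq lessThan_empty_iff)
    fix u v assume "u \<in> verts (with_proj T)" "v \<in> verts (with_proj T)"
    then obtain i j where "i < n" "j < n" "u = f i" "v = f j" by (auto simp: pverts_eq)
    then show "u \<rightarrow>\<^sup>*\<^bsub>with_proj T\<^esub> v"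
      using root[of i] symmetric_reachable'[OF root[of j]] reachable_trans by blast
  qed
qed

lemma connected: "Digraph_Component.connected (with_proj T)"
proof -
  interpret pair_graph T by (rule pair_graph)
  show ?thesis
    using strongly_connected
    by (auto simp: Digraph_Component.connected_def strongly_connected_def
        intro: reachable_mk_symmetricI)
qed

end

text \<open>Turns a cycle, given as a list of arcs, into distinct vertices indexed cyclically:
  \<open>w k\<close> is the tail of the \<open>k\<close>-th arc.\<close>

lemma (in pair_wf_digraph) cycle_verts:
  assumes "cycle c"
  obtains w where "inj_on w {..<length c}"
    "\<And>k. k < length c \<Longrightarrow> (w k, w (Suc k mod length c)) \<in> parcs G"
proof -
  let ?L = "length c"
  obtain u where u: "awalk u c u" "distinct (tl (awalk_verts u c))" "c \<noteq> []"
    using assms unfolding cycle_def by blast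
  \<comment> \<open>The definition of \<open>cycle\<close> makes the vertex list without its first
    entry distinct; this is the list of arc tails rotated by one place.\<close>
  have dist: "distinct (map fst c)"
  proof -
    have "tl (awalk_verts u c) = tl (map fst c) @ [u]"
      using u awalk_verts_conv[of u c] awlast_of_awalk[OF u(1)] by (cases c) (auto simp: NOMATCH_def)
    moreover have "fst (hd c) = u" using u by (cases c) (auto simp: awalk_Cons_iff)
    ultimately show ?thesis using u(2,3) by (cases c) auto
  qed
  have next_fst: "snd (c ! k) = fst (c ! (Suc k mod ?L))" if "k < ?L" for k
  proof (cases "Suc k = ?L")
    case True
    have "snd (last c) = u"
      using awlast_of_awalk[OF u(1)] u(3) awalk_verts_conv[of u c] by (auto simp: NOMATCH_def)
    moreover have "fst (hd c) = u" using u by (cases c) (auto simp: awalk_Cons_iff)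
    moreover have "last c = c ! k" using u(3) True by (metis diff_Suc_1 last_conv_nth)
    moreover have "hd c = c ! (Suc k mod ?L)" using u(3) by (simp add: hd_conv_nth True)
    ultimately show ?thesis by simp
  next
    case False
    then have k: "Suc k < ?L" using that by simp
    have "c = take k c @ c ! k # c ! Suc k # drop (Suc (Suc k)) c"
      using k by (simp add: Cons_nth_drop_Suc)
    then have "awalk u (take k c @ c ! k # c ! Suc k # drop (Suc (Suc k)) c) u"
      using u(1) by simp
    then have "snd (c ! k) = fst (c ! Suc k)"
      by (simp add: awalk_Cons_iff)
    then show ?thesis using k by simp
  qed
  show thesis
  proof (rule that[of "\<lambda>k. fst (c ! k)"])
    show "inj_on (\<lambda>k. fst (c ! k)) {..<?L}"
      using dist by (auto simp: inj_on_def distinct_conv_nth)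
    fix k assume k: "k < ?L"
    have "c ! k \<in> parcs G" using u(1) k by (auto simp: awalk_def)
    then show "(fst (c ! k), fst (c ! (Suc k mod ?L))) \<in> parcs G"
      using next_fst[OF k] by (metis prod.collapse)
  qed
qed

text \<open>The largest vertex of a long cycle would have two parents.\<close>
lemma (in rooted_tree) no_long_cycle:
  assumes "pre_digraph.cycle (with_proj T) c"
  shows "length c < 3"
proof (rule ccontr)
  let ?L = "length c"
  assume "\<not> ?L < 3"
  then have L: "3 \<le> ?L" by simp
  interpret G: pair_graph T by (rule pair_graph)
  obtain w where w: "inj_on w {..<?L}" "\<And>k. k < ?L \<Longrightarrow> (w k, w (Suc k mod ?L)) \<in> parcs T"
    using G.cycle_verts[OF assms] by blast
  have "\<exists>j<n. w k = f j" if "k < ?L" for k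
    using G.in_arcsD1[OF w(2)[OF that]] by (auto simp: pverts_eq)
  then obtain g where g: "\<And>k. k < ?L \<Longrightarrow> g k < n \<and> w k = f (g k)" by metis
  have g_inj: "g i = g j \<Longrightarrow> i = j" if "i < ?L" "j < ?L" for i j
    using inj_onD[OF w(1), of i j] g that by auto
  have adj: "g (Suc k mod ?L) \<in> nbrs (g k)" if "k < ?L" for k
  proof -
    have "Suc k mod ?L < ?L" using L by (intro mod_less_divisor) linarith
    then show ?thesis using w(2)[OF that] parc_iff g that by metis
  qed
  obtain k where k: "k < ?L" and kmax: "\<And>i. i < ?L \<Longrightarrow> g i \<le> g k"
  proof -
    have "Max (g ` {..<?L}) \<in> g ` {..<?L}" using L by (intro Max_in) (auto simp: lessThan_empty_iff)
    then obtain k where "k < ?L" "g k = Max (g ` {..<?L})" by auto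
    then show thesis using that[of k] by simp
  qed
  \<comment> \<open>A neighbour whose index is not larger can only be the parent.\<close>
  have up: "g i = p (g k)" if "i < ?L" "g i \<in> nbrs (g k)" for i
    using that kmax[of i] parent_less[of "g i"] by (auto simp: nbrs_def)
  \<comment> \<open>Adding \<open>?L\<close> before subtracting 1 gives the cyclic predecessor also
    for \<open>k = 0\<close>.\<close>
  define prev where "prev = (k + ?L - 1) mod ?L"
  define nxt where "nxt = Suc k mod ?L"
  have lt: "prev < ?L" "nxt < ?L" 
    using L unfolding prev_def nxt_def by (intro mod_less_divisor; linarith)+
  have "Suc prev mod ?L = Suc (k + ?L - 1) mod ?L" by (simp add: prev_def mod_Suc_eq)
  also have "Suc (k + ?L - 1) = k + ?L" using L by simp
  finally have "Suc prev mod ?L = k" using k by simp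
  then have "g k \<in> nbrs (g prev)" using adj[OF lt(1)] by simp
  then have "g prev = p (g k)" using nbrs_sym up lt g by blast
  moreover have "g nxt = p (g k)" using up lt adj[OF k] by (simp add: nxt_def)
  ultimately have "prev = nxt" using g_inj lt by simp
  moreover have "nxt = (if Suc k = ?L then 0 else Suc k)"
    using k by (simp add: nxt_def)
  moreover have "prev = (if k = 0 then ?L - 1 else k - 1)"
  proof (cases "k = 0")
    case False
    then have eq: "k + ?L - 1 = (k - 1) + ?L" by simp
    have "prev = (k - 1) mod ?L" unfolding prev_def eq by (rule mod_add_self2)
    then show ?thesis using k False by simp
  qed (use L in \<open>simp add: prev_def\<close>)
  \<comment> \<open>The predecessor and the successor on a cycle of length at least 3 are different
    positions.\<close>
  ultimately show False using L k by (auto split: if_splits)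
qed

lemma (in rooted_tree) tree_with: "tree_with n (max_degree T) T"
  using pair_graph connected no_long_cycle
  by (force simp: tree_with_def undirected_tree_def pverts_eq card_image[OF inj] not_le)

section \<open>Numbering the vertices of an undirected tree\<close>

lemma (in wf_digraph) reachable_crossing_arc:
  assumes "u \<rightarrow>\<^sup>* v" "u \<in> S" "v \<notin> S"
  obtains a b where "a \<rightarrow> b" "a \<in> S" "b \<notin> S"
  using assms
proof (induction arbitrary: thesis rule: reachable_induct)
  case (step x y)
  then show ?case by blast
qed blast

text \<open>The numbering grows greedily: some arc leaves the set of numbered vertices, its new end
  receives the next number and its old end becomes the parent. Acyclicity then shows that the parent
  arcs are all the arcs.\<close>

lemma undirected_tree_imp_rooted_tree:
  assumes T: "undirected_tree T" and n: "card (pverts T) = n" "2 \<le> n"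
  shows "\<exists>f p. rooted_tree T n f p"
proof -
  interpret pair_graph T using T by (simp add: undirected_tree_def)
  have sc: "strongly_connected (with_proj T)"
    using T symmetric_connected_imp_strongly_connected pair_sym_arcs
    by (simp add: undirected_tree_def)
  have partial: "\<exists>f p. (\<forall>i>0. p i < i) \<and> inj_on f {..<m} \<and> f ` {..<m} \<subseteq> pverts T \<and>
      (\<forall>i. 0 < i \<and> i < m \<longrightarrow> (f i, f (p i)) \<in> parcs T)" if "1 \<le> m" "m \<le> n" for m
    using that
  proof (induction m rule: nat_induct_at_least)
    case base
    obtain v where "v \<in> pverts T" using n by fastforce
    \<comment> \<open>The constant parent \<open>0\<close> satisfies \<open>p i < i\<close> also at
      the indices still to be assigned.\<close>
    then show ?case by (intro exI[of _ "\<lambda>_. v"] exI[of _ "\<lambda>_. 0"]) (auto simp: inj_on_def)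
  next
    case (Suc m)
    then obtain f and p :: "nat \<Rightarrow> nat" where p: "\<forall>i>0. p i < i"
      and f: "inj_on f {..<m}" "f ` {..<m} \<subseteq> pverts T"
      and arcs: "\<forall>i. 0 < i \<and> i < m \<longrightarrow> (f i, f (p i)) \<in> parcs T"
      by auto
    have "card (f ` {..<m}) < card (pverts T)"
      using Suc.prems n by (simp add: card_image[OF f(1)])
    then have "\<not> pverts T \<subseteq> f ` {..<m}" using card_mono[of "f ` {..<m}" "pverts T"] by auto
    then obtain v where v: "v \<in> pverts T" "v \<notin> f ` {..<m}" by blast
    have f0: "f 0 \<in> f ` {..<m}" using Suc.hyps by simp
    then have "f 0 \<rightarrow>\<^sup>*\<^bsub>with_proj T\<^esub> v"
      using sc v f(2) by (auto simp: strongly_connected_def)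
    then obtain a b where ab: "(a, b) \<in> parcs T" "a \<in> f ` {..<m}" "b \<notin> f ` {..<m}"
      using reachable_crossing_arc[OF _ f0 v(2)] by blast
    then obtain k where k: "k < m" "a = f k" by auto
    have b: "b \<in> pverts T" "(b, f k) \<in> parcs T"
      using ab k in_arcsD2 arcs_symmetric by auto
    show ?case
    proof (intro exI conjI allI impI)
      show "0 < i \<Longrightarrow> (p(m := k)) i < i" for i using p k by simp
      show "inj_on (f(m := b)) {..<Suc m}"
        using f(1) ab(3) by (auto simp: inj_on_def lessThan_Suc)
      show "f(m := b) ` {..<Suc m} \<subseteq> pverts T"
        using f(2) b by (auto simp: lessThan_Suc)
      fix i assume i: "0 < i \<and> i < Suc m"
      show "((f(m := b)) i, (f(m := b)) ((p(m := k)) i)) \<in> parcs T"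
      proof (cases "i = m")
        case True
        then show ?thesis using b k by simp
      next
        case False
        moreover have "p i < i" using p i by simp
        ultimately show ?thesis using arcs i by simp
      qed
    qed
  qed
  have "1 \<le> n" using n(2) by simp
  from partial[OF this order_refl] obtain f and p :: "nat \<Rightarrow> nat" where p: "\<forall>i>0. p i < i"
    and f: "inj_on f {..<n}" "f ` {..<n} \<subseteq> pverts T"
    and arcs: "\<forall>i. 0 < i \<and> i < n \<longrightarrow> (f i, f (p i)) \<in> parcs T"
    by blast
  have fV: "f ` {..<n} = pverts T"
    using f n pair_finite_verts by (intro card_subset_eq) (auto simp: card_image)
  \<comment> \<open>The spanning tree formed by the chosen arcs and their reverses.\<close>
  define H where "H = \<lparr>pverts = pverts T,
    parcs = (\<lambda>i. (f i, f (p i))) ` {1..<n} \<union> (\<lambda>i. (f (p i), f i)) ` {1..<n}\<rparr>"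
  have H: "rooted_tree H n f p"
    using n p f fV by unfold_locales (auto simp: H_def)
  interpret H: rooted_tree H n f p by (rule H)
  interpret HG: pair_graph H by (rule H.pair_graph)
  have "parcs H \<subseteq> parcs T"
    using arcs arcs_symmetric by (auto simp: H_def Suc_le_eq)
  then have "subgraph (with_proj H) (with_proj T)"
    using wf_digraph_axioms HG.wf_digraph_axioms by (intro subgraphI) (auto simp: H_def)
  moreover
  txt \<open>A further arc would close the path between its ends in \<open>H\<close> to a cycle.\<close>
  have "(a, b) \<in> parcs H" if ab: "(a, b) \<in> parcs T" for a b
  proof (rule ccontr)
    assume nH: "(a, b) \<notin> parcs H"
    have V: "a \<in> pverts T" "b \<in> pverts T" "a \<noteq> b"
      using ab in_arcsD1 in_arcsD2 no_loops' by blast+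
    then have "b \<rightarrow>\<^sup>*\<^bsub>with_proj H\<^esub> a"
      using H.strongly_connected by (auto simp: strongly_connected_def H_def)
    then obtain c where c: "HG.apath b c a" using HG.reachable_apath by blast
    then have cT: "apath b c a"
      using subgraph_apath_imp_apath[OF _ \<open>subgraph (with_proj H) (with_proj T)\<close>] by blast
    have "cycle ((a, b) # c)"
      using cT ab unfolding cycle_def apath_def by (auto simp: awalk_Cons_iff)
    \<comment> \<open>Hence the path in \<open>H\<close> from \<open>b\<close> to \<open>a\<close>
      is the single arc \<open>(b, a)\<close>, whose reverse also lies in \<open>H\<close>.\<close>
    then have "length ((a, b) # c) < 3" using T by (auto simp: undirected_tree_def not_le)
    then have "length c < 2" by simp
    then consider "c = []" | e where "c = [e]" by (cases c) auto
    then show False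
    proof cases
      case 1
      then show False using c V(3) by (simp add: HG.apath_Nil_iff)
    next
      case 2
      then have "(b, a) \<in> parcs H" using c by (auto simp: HG.apath_Cons_iff HG.apath_Nil_iff)
      then show False using nH HG.arcs_symmetric by blast
    qed
  qed
  ultimately have "parcs H = parcs T" using \<open>parcs H \<subseteq> parcs T\<close> by auto
  then have "rooted_tree T n f p"
    using n p f fV by unfold_locales (auto simp: H_def)
  then show ?thesis by blast
qed

section \<open>Brooms and spiders\<close>

definition parent_tree :: "nat \<Rightarrow> (nat \<Rightarrow> nat) \<Rightarrow> nat pair_pre_digraph" where
  "parent_tree n p = \<lparr>pverts = {..<n},
    parcs = (\<lambda>i. (i, p i)) ` {1..<n} \<union> (\<lambda>i. (p i, i)) ` {1..<n}\<rparr>"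

lemma rooted_tree_parent_tree:
  assumes "2 \<le> n" "\<And>i. 0 < i \<Longrightarrow> p i < i"
  shows "rooted_tree (parent_tree n p) n (\<lambda>i. i) p"
  using assms by unfold_locales (auto simp: parent_tree_def)

text \<open>A star with centre \<open>0\<close> and leaves \<open>1\<close> to \<open>d\<close>,
  where a path through \<open>d + 1, d + 2, ...\<close> is attached at the leaf
  \<open>d\<close>.\<close>

definition broom :: "nat \<Rightarrow> nat \<Rightarrow> nat" where
  "broom d i = (if i \<le> d then 0 else i - 1)"

text \<open>The legs are the residue classes modulo \<open>d\<close>, hence of almost equal lengths.\<close>
definition spider :: "nat \<Rightarrow> nat \<Rightarrow> nat" where
  "spider d i = (if i \<le> d then 0 else i - d)"

text \<open>These are the pairs that occur for trees: \<open>tree_with_imp_feasible_degree\<close>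
  gives one direction, the brooms give the other.\<close>

locale feasible_degree =
  fixes n d :: nat
  assumes n: "2 \<le> n" and d: "1 \<le> d" "d < n" "d = 1 \<Longrightarrow> n = 2"
begin

sublocale broom: rooted_tree "parent_tree n (broom d)" n "\<lambda>i. i" "broom d"
  using n d by (intro rooted_tree_parent_tree) (auto simp: broom_def)

sublocale spider: rooted_tree "parent_tree n (spider d)" n "\<lambda>i. i" "spider d"
  using n d by (intro rooted_tree_parent_tree) (auto simp: spider_def)

section \<open>Degrees of brooms and spiders\<close>

text \<open>Vertices other than the centre have at most a parent and one child. This fits
  \<open>d \<ge> 2\<close>; for \<open>d = 1\<close> there is only one other vertex.\<close>

lemma card_le_degree:
  assumes "A \<subseteq> {a, b}" "A \<subseteq> {..<n} - {i}" "i < n"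
  shows "card A \<le> d"
proof (cases "d = 1")
  case True
  have "card A \<le> card ({..<n} - {i})" using assms(2) by (intro card_mono) auto
  then show ?thesis using True d assms(3) by simp
next
  case False
  have "card A \<le> card {a, b}" using assms(1) by (intro card_mono) auto
  also have "\<dots> \<le> 2" by (simp add: card_insert_if)
  finally show ?thesis using False d by simp
qed

lemma max_degree_broom: "max_degree (parent_tree n (broom d)) = d"
proof (rule broom.max_degree_eqI[of 0])
  have "broom.nbrs 0 = {1..d}"
    using d by (auto simp: broom.nbrs_def broom_def split: if_splits)
  then show "card (broom.nbrs 0) = d" by simp
  then show "card (broom.nbrs i) \<le> d" if "i < n" for i
  proof (cases "i = 0")
    case False
    then have "broom.nbrs i \<subseteq> {broom d i, Suc i}"
      by (auto simp: broom.nbrs_def broom_def split: if_splits)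
    then show ?thesis using card_le_degree broom.nbrs_subset that by blast
  qed simp
qed (use n in simp)

lemma max_degree_spider: "max_degree (parent_tree n (spider d)) = d"
proof (rule spider.max_degree_eqI[of 0])
  have "spider.nbrs 0 = {1..d}"
    using d by (auto simp: spider.nbrs_def spider_def split: if_splits)
  then show "card (spider.nbrs 0) = d" by simp
  then show "card (spider.nbrs i) \<le> d" if "i < n" for i
  proof (cases "i = 0")
    case False
    then have "spider.nbrs i \<subseteq> {spider d i, i + d}"
      by (auto simp: spider.nbrs_def spider_def split: if_splits)
    then show ?thesis using card_le_degree spider.nbrs_subset that by blast
  qed simp
qed (use n in simp)

section \<open>Brooms attain the lower bounds\<close>

lemma broom_size:
  assumes "d \<le> i" "i < n"
  shows "broom.size i = n - i"
proof -
  have mem: "i \<in> broom.anc j \<longleftrightarrow> i \<le> j" for j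
  proof (induction j rule: less_induct)
    case (less j)
    show ?case
    proof (cases "j \<le> i")
      case True
      then show ?thesis using ancestors_subset[of "broom d" j] by (cases "j = i") auto
    next
      case False
      then have "broom d j = j - 1" "0 < j" using assms by (auto simp: broom_def)
      then have "broom.anc j = insert j (broom.anc (j - 1))" using broom.anc_Suc[of j] by simp
      moreover have "i \<in> broom.anc (j - 1)" using less.IH[of "j - 1"] False by simp
      ultimately show ?thesis using False by simp
    qed
  qed
  have "broom.descendants i = {i..<n}" unfolding broom.descendants_def mem by auto
  then show ?thesis by simp
qed

text \<open>Cutting the handle above \<open>i\<close> separates \<open>n - i\<close> vertices, so
  every split with \<open>i \<ge> d\<close> occurs, including the most balanced one that the degree
  permits.\<close>

lemma l1_fiedler_broom_le:
  assumes "d \<le> i" "i < n"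
  shows "l1_fiedler (parent_tree n (broom d)) \<le> n / (2 * (real i * (real n - i)))"
  using broom.l1_fiedler_le[of i] assms d by (simp add: broom_size of_nat_diff mult.commute)

lemma l1_fiedler_broom_even:
  assumes "even n"
  shows "l1_fiedler (parent_tree n (broom d)) = lower_bound_even n d"
proof (rule antisym)
  show "lower_bound_even n d \<le> l1_fiedler (parent_tree n (broom d))"
    using broom.lower_bound_even_le[OF assms] by (simp add: max_degree_broom)
  obtain m where m: "n = 2 * m" using assms by blast
  show "l1_fiedler (parent_tree n (broom d)) \<le> lower_bound_even n d"
  proof (cases "d \<le> m")
    case True
    then show ?thesis using l1_fiedler_broom_le[of m] n m by (simp add: lower_bound_even_def)
  next
    case False
    then show ?thesis
      using l1_fiedler_broom_le[of d] d m by (simp add: lower_bound_even_def mult.assoc)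
  qed
qed

text \<open>The split into \<open>m + 1\<close> and \<open>m\<close> vertices is the cut at
  \<open>i = m + 1\<close>, available when \<open>d \<le> m + 1\<close>; beyond this threshold the
  cut at \<open>i = d\<close> is used.\<close>

lemma l1_fiedler_broom_odd:
  assumes "odd n"
  shows "l1_fiedler (parent_tree n (broom d)) = lower_bound_odd n d"
proof (rule antisym)
  show "lower_bound_odd n d \<le> l1_fiedler (parent_tree n (broom d))"
    using broom.lower_bound_odd_le[OF assms] by (simp add: max_degree_broom)
  obtain m where m: "n = 2 * m + 1" using assms by (rule oddE)
  have fl: "\<lfloor>real n / 2\<rfloor> = int m" by (simp add: m floor_eq_iff)
  show "l1_fiedler (parent_tree n (broom d)) \<le> lower_bound_odd n d"
  proof (cases "d \<le> m + 1")
    case True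
    have eq: "real (m + 1) * (real n - real (m + 1)) = ((real n)\<^sup>2 - 1) / 4"
      by (simp add: m power2_eq_square algebra_simps)
    have "m + 1 < n" using n m by simp
    then have "l1_fiedler (parent_tree n (broom d)) \<le> n / (2 * (((real n)\<^sup>2 - 1) / 4))"
      using l1_fiedler_broom_le[OF True] unfolding eq by simp
    also have "\<dots> = 2 * real n / ((real n)\<^sup>2 - 1)" by (simp add: divide_simps)
    finally show ?thesis using True by (simp add: lower_bound_odd_def fl)
  next
    case False
    then show ?thesis
      using l1_fiedler_broom_le[of d] d by (simp add: lower_bound_odd_def fl mult.assoc)
  qed
qed

section \<open>Spiders attain the upper bounds\<close>

text \<open>The descendants of \<open>i\<close> lie in the progression \<open>i, i + d, ...\<close>,
  and at most \<open>K\<close> of its terms are below \<open>n\<close> because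
  \<open>i \<ge> 1\<close>.\<close>

lemma spider_size_le:
  assumes "n - 1 \<le> K * d" "0 < i" "i < n"
  shows "spider.size i \<le> K"
proof -
  have leg: "\<exists>q. j = i + q * d" if "i \<in> spider.anc j" for j
    using that
  proof (induction j rule: less_induct)
    case (less j)
    show ?case
    proof (cases "j = i")
      case False
      have "0 < j" using less.prems assms(2) spider.anc_0 by (cases "j = 0") auto
      then have i: "i \<in> spider.anc (spider d j)" "spider d j < j"
        using less.prems False by (auto simp: spider.anc_Suc spider.parent_less)
      then obtain q where q: "spider d j = i + q * d" using less.IH by blast
      then have "d < j" using assms(2) by (auto simp: spider_def split: if_splits)
      then have "j = i + Suc q * d" using q by (simp add: spider_def)
      then show ?thesis by blast
    qed (auto intro: exI[of _ 0])
  qed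
  have "spider.descendants i \<subseteq> (\<lambda>q. i + q * d) ` {..<K}"
  proof
    fix j assume "j \<in> spider.descendants i"
    then obtain q where q: "j = i + q * d" "j < n" using leg by (auto simp: spider.descendants_def)
    then have "q * d < K * d" using assms by linarith
    then show "j \<in> (\<lambda>q. i + q * d) ` {..<K}" using q by auto
  qed
  then have "spider.size i \<le> card ((\<lambda>q. i + q * d) ` {..<K})" by (intro card_mono) auto
  also have "\<dots> \<le> K" using card_image_le[of "{..<K}"] by simp
  finally show ?thesis .
qed

text \<open>Every edge cuts off at most \<open>K \<le> n / 2\<close> vertices, so none is more
  balanced than a split into \<open>K\<close> and \<open>n - K\<close>.\<close>

lemma l1_fiedler_spider_ge:
  assumes "n - 1 \<le> K * d" "0 < K" "2 * K \<le> n"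
  shows "n / (2 * (real K * (real n - K))) \<le> l1_fiedler (parent_tree n (spider d))"
proof (rule spider.l1_fiedler_ge)
  show "real (spider.size i) * (real n - spider.size i) \<le> real K * (real n - K)"
    if "0 < i" "i < n" for i
    using spider_size_le[OF assms(1) that] assms(3) by (intro mult_diff_mono) auto
  show "0 < real K * (real n - real K)" using assms by simp
qed

lemma l1_fiedler_spider_dvd:
  assumes "1 \<le> k" "n - 1 = k * d"
  shows "l1_fiedler (parent_tree n (spider d)) = upper_bound_dvd n k"
proof (rule antisym)
  show "l1_fiedler (parent_tree n (spider d)) \<le> upper_bound_dvd n k"
    using spider.upper_bound_dvd_ge assms by (simp add: max_degree_spider)
  \<comment> \<open>For \<open>d \<ge> 2\<close> even \<open>2 * k \<le> n - 1\<close> holds; for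
    \<open>d = 1\<close> the tree is a single edge and \<open>k = 1\<close>.\<close>
  have "2 * k \<le> n"
  proof (cases "d = 1")
    case False
    then have "k * 2 \<le> k * d" using d by simp
    then show ?thesis using assms n by linarith
  qed (use assms d in simp)
  then show "upper_bound_dvd n k \<le> l1_fiedler (parent_tree n (spider d))"
    using l1_fiedler_spider_ge[of k] assms by (simp add: upper_bound_dvd_def mult.assoc)
qed

lemma l1_fiedler_spider_not_dvd:
  assumes "1 \<le> k" "1 \<le> r" "r < d" "n - 1 = k * d + r"
  shows "l1_fiedler (parent_tree n (spider d)) = upper_bound_not_dvd n k"
proof (rule antisym)
  show "l1_fiedler (parent_tree n (spider d)) \<le> upper_bound_not_dvd n k"
    using spider.upper_bound_not_dvd_ge assms by (simp add: max_degree_spider)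
  \<comment> \<open>Here \<open>1 \<le> r < d\<close> forces \<open>d \<ge> 2\<close>.\<close>
  have "k * 2 + 1 \<le> k * d + r" using assms by (intro add_mono mult_left_mono) auto
  then have "2 * (k + 1) \<le> n" using assms(4) by simp
  then show "upper_bound_not_dvd n k \<le> l1_fiedler (parent_tree n (spider d))"
    using l1_fiedler_spider_ge[of "k + 1"] assms
    by (simp add: upper_bound_not_dvd_def algebra_simps)
qed

lemma tree_with_broom: "tree_with n d (parent_tree n (broom d))"
  using broom.tree_with by (simp add: max_degree_broom)

lemma tree_with_spider: "tree_with n d (parent_tree n (spider d))"
  using spider.tree_with by (simp add: max_degree_spider)

end

section \<open>Transfer to arbitrary trees and conclusion\<close>

lemma tree_with_imp_rooted_tree:
  assumes "2 \<le> n" "tree_with n d T"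
  obtains f p where "rooted_tree T n f p" "max_degree T = d"
  using assms undirected_tree_imp_rooted_tree unfolding tree_with_def by blast

lemma tree_with_imp_feasible_degree:
  assumes n: "2 \<le> n" and T: "tree_with n d T"
  shows "feasible_degree n d"
proof -
  obtain f p where "rooted_tree T n f p" and md: "max_degree T = d"
    using tree_with_imp_rooted_tree[OF assms] .
  then interpret rooted_tree T n f p by simp
  have "n = 2" if "d = 1"
    using that n max_degree_ge_2 md by (cases "3 \<le> n") auto
  then show ?thesis
    using n max_degree_pos max_degree_less md by unfold_locales auto
qed

theorem theorem4p4:
  shows
    "(\<forall>(T :: 'a pair_pre_digraph) n d. 2 \<le> n \<and> tree_with n d T \<longrightarrow>
       (even n \<longrightarrow> l1_fiedler T \<ge> lower_bound_even n d) \<and>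
       (odd n \<longrightarrow> l1_fiedler T \<ge> lower_bound_odd n d) \<and>
       (\<forall>k\<ge>1. n - 1 = k * d \<longrightarrow> l1_fiedler T \<le> upper_bound_dvd n k) \<and>
       (\<forall>k\<ge>1. \<forall>r. 1 \<le> r \<and> r < d \<and> n - 1 = k * d + r \<longrightarrow>
          l1_fiedler T \<le> upper_bound_not_dvd n k)) \<and>
     (\<forall>n d. 2 \<le> n \<and> (\<exists>T :: nat pair_pre_digraph. tree_with n d T) \<longrightarrow>
       (even n \<longrightarrow>
          (\<exists>T :: nat pair_pre_digraph. tree_with n d T \<and> l1_fiedler T = lower_bound_even n d)) \<and>
       (odd n \<longrightarrow>
          (\<exists>T :: nat pair_pre_digraph. tree_with n d T \<and> l1_fiedler T = lower_bound_odd n d)) \<and>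
       (\<forall>k\<ge>1. n - 1 = k * d \<longrightarrow>
          (\<exists>T :: nat pair_pre_digraph. tree_with n d T \<and> l1_fiedler T = upper_bound_dvd n k)) \<and>
       (\<forall>k\<ge>1. \<forall>r. 1 \<le> r \<and> r < d \<and> n - 1 = k * d + r \<longrightarrow>
          (\<exists>T :: nat pair_pre_digraph. tree_with n d T \<and> l1_fiedler T = upper_bound_not_dvd n k)))"
    (is "?bounds \<and> ?sharp")
proof
  show ?bounds
  proof (intro allI impI, elim conjE)
    fix T :: "'a pair_pre_digraph" and n d
    assume "2 \<le> n" "tree_with n d T"
    then obtain f p where "rooted_tree T n f p" and md: "max_degree T = d"
      by (rule tree_with_imp_rooted_tree)
    then interpret rooted_tree T n f p by simp
    show "(even n \<longrightarrow> l1_fiedler T \<ge> lower_bound_even n d) \<and>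
       (odd n \<longrightarrow> l1_fiedler T \<ge> lower_bound_odd n d) \<and>
       (\<forall>k\<ge>1. n - 1 = k * d \<longrightarrow> l1_fiedler T \<le> upper_bound_dvd n k) \<and>
       (\<forall>k\<ge>1. \<forall>r. 1 \<le> r \<and> r < d \<and> n - 1 = k * d + r \<longrightarrow>
          l1_fiedler T \<le> upper_bound_not_dvd n k)"
      using lower_bound_even_le lower_bound_odd_le upper_bound_dvd_ge upper_bound_not_dvd_ge
      unfolding md by blast
  qed
  show ?sharp
  proof (intro allI impI, elim conjE exE)
    fix n d and T :: "nat pair_pre_digraph"
    assume "2 \<le> n" "tree_with n d T"
    \<comment> \<open>The given tree shows that \<open>d\<close> is feasible; the witnesses are the
      broom for the lower bounds and the spider for the upper bounds.\<close>
    then interpret feasible_degree n d by (rule tree_with_imp_feasible_degree)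
    show "(even n \<longrightarrow>
          (\<exists>T :: nat pair_pre_digraph. tree_with n d T \<and> l1_fiedler T = lower_bound_even n d)) \<and>
       (odd n \<longrightarrow>
          (\<exists>T :: nat pair_pre_digraph. tree_with n d T \<and> l1_fiedler T = lower_bound_odd n d)) \<and>
       (\<forall>k\<ge>1. n - 1 = k * d \<longrightarrow>
          (\<exists>T :: nat pair_pre_digraph. tree_with n d T \<and> l1_fiedler T = upper_bound_dvd n k)) \<and>
       (\<forall>k\<ge>1. \<forall>r. 1 \<le> r \<and> r < d \<and> n - 1 = k * d + r \<longrightarrow>
          (\<exists>T :: nat pair_pre_digraph. tree_with n d T \<and> l1_fiedler T = upper_bound_not_dvd n k))"
      using tree_with_broom tree_with_spider l1_fiedler_broom_even l1_fiedler_broom_odd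
        l1_fiedler_spider_dvd l1_fiedler_spider_not_dvd by metis
  qed
qed

end
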